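(* Let $f:\mathbb{R}^d\to\mathbb{R}$ be glocally $(L,L_*,\delta)$-smooth and $\mu$-strongly convex with $\mu>0$. Let $w_0\in\mathbb{R}^d$, let $f_*$ be the infimum of $f$, put $\Delta_0=f(w_0)-f_*$, and let $\epsilon$ satisfy $\Delta_0>\delta>\epsilon>0$. For all $t\ge 0$ let $$w_{t+1}=w_t-\eta_t\nabla f(w_t),\qquad \eta_t\in\arg\min_{\eta} f(w_t-\eta\nabla f(w_t)).$$ Then $f(w_T)-f_*\le\epsilon$ for all integers $T$ with $$T\ge \frac{L}{\mu}\log\left(\frac{\Delta_0}{\delta}\right)+\frac{L_*}{\mu}\log\left(\frac{\delta}{\epsilon}\right)+1.$$
   Context: $\|\cdot\|$ is the Euclidean norm, functions are differentiable, and $L,L_*,\delta>0$. Glocal smoothness: $f$ with infimum $f_*$ is glocally $(L,L_*,\delta)$-smooth if (i) $\|\nabla f(u)-\nabla f(v)\|\le L\|u-v\|$ for all $u,v\in\mathbb{R}^d$, and (ii) $\|\nabla f(u)-\nabla f(v)\|\le L_*\|u-v\|$ for all $u,v$ in the set $\{u: f(u)-f_*\le\delta\}$. Strong convexity: $f$ is $\mu$-strongly convex if $f(v)\ge f(u)+\langle\nabla f(u),v-u\rangle+\frac{\mu}{2}\|v-u\|^2$ for all $u,v\in\mathbb{R}^d$. *)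

theory Defs
  imports "HOL-Analysis.Analysis"
begin

definition gradient :: "('a::real_inner \<Rightarrow> real) \<Rightarrow> 'a \<Rightarrow> 'a" where
  "gradient f x = (THE D. GDERIV f x :> D)"

lemma gradient_eqI:
  assumes "GDERIV f x :> D"
  shows "gradient f x = D"
  unfolding gradient_def
proof (rule the_equality)
  show "GDERIV f x :> D" by (rule assms)
next
  fix E
  assume "GDERIV f x :> E"
  then have "(\<lambda>h. h \<bullet> E) = (\<lambda>h. h \<bullet> D)"
    using assms has_derivative_unique[of f "\<lambda>h. h \<bullet> E" x "\<lambda>h. h \<bullet> D"]
    by (simp only: gderiv_def)
  then show "E = D"
    using vector_eq_ldot[of E D] by (simp only: fun_eq_iff)
qed

lemma GDERIV_gradient:
  fixes f :: "'a::euclidean_space \<Rightarrow> real"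
  assumes "f differentiable (at x)"
  shows "GDERIV f x :> gradient f x"
proof -
  obtain f' where f': "(f has_derivative f') (at x)"
    using assms unfolding differentiable_def by blast
  then have "linear f'"
    by (rule has_derivative_linear)
  then have "f' h = h \<bullet> adjoint f' 1" for h
    using adjoint_works[of f' h 1] by simp
  then have "(\<lambda>h. h \<bullet> adjoint f' 1) = f'"
    by (intro ext) (rule sym)
  with f' have "GDERIV f x :> adjoint f' 1"
    by (simp only: gderiv_def)
  then show ?thesis
    using gradient_eqI[of f x "adjoint f' 1"] by simp
qed

text \<open>Boundedness below ensures that \<open>INF x. f x\<close> is the actual infimum of \<open>f\<close>:
  on the reals it is unspecified otherwise.\<close>

definition glocally_smooth :: "('a::real_inner \<Rightarrow> real) \<Rightarrow> real \<Rightarrow> real \<Rightarrow> real \<Rightarrow> bool" where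
  "glocally_smooth f L Ls \<delta> \<longleftrightarrow>
     bdd_below (range f) \<and>
     (\<forall>u v. norm (gradient f u - gradient f v) \<le> L * norm (u - v)) \<and>
     (\<forall>u\<in>{x. f x - (INF y. f y) \<le> \<delta>}. \<forall>v\<in>{x. f x - (INF y. f y) \<le> \<delta>}.
        norm (gradient f u - gradient f v) \<le> Ls * norm (u - v))"

definition strongly_convex :: "real \<Rightarrow> ('a::real_inner \<Rightarrow> real) \<Rightarrow> bool" where
  "strongly_convex \<mu> f \<longleftrightarrow>
     (\<forall>u v. f v \<ge> f u + gradient f u \<bullet> (v - u) + \<mu> / 2 * (norm (v - u))\<^sup>2)"

end

theory Submission
  imports Defs
begin

text \<open>
  Exact line search is at least as good as any fixed step along the negative gradient, so it
  adapts to whichever smoothness constant is valid near the current iterate. If the gradient is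
  \<open>K\<close>-Lipschitz on the sublevel set \<open>{x. f x \<le> f w}\<close>, one step from \<open>w\<close> multiplies the gap
  \<open>f w - f\<^sub>*\<close> by at most \<open>1 - \<mu> / K \<le> exp (- \<mu> / K)\<close>
  (\<open>line_search_contraction\<close>). The decrease is obtained by comparison with the step of length
  \<open>1 / K\<close>, and strong convexity turns the resulting decrease \<open>(norm (gradient f w))\<^sup>2 / (2 * K)\<close>
  into a fraction of the gap (\<open>gradient_dominates_gap\<close>).

  The delicate point is that the descent inequality needs the Lipschitz bound on the whole segment
  travelled by the step \<open>1 / K\<close>, while the bound is only local. Line search provides this:
  the gradient at the minimiser is orthogonal to the search direction, so along the step it has
  changed by at least its full initial norm, which forces the step size to be at least \<open>1 / K\<close>.
  Hence the comparison point lies between two points of a convex sublevel set.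

  With \<open>K = L\<close>, about \<open>L / \<mu> * ln (\<Delta>0 / \<delta>)\<close> steps bring the gap below \<open>\<delta>\<close>. From then on the
  sublevel sets of the iterates lie in the region where \<open>K = Ls\<close> is valid, and
  \<open>Ls / \<mu> * ln (\<delta> / \<epsilon>)\<close> further steps reach \<open>\<epsilon>\<close>. The summand \<open>1\<close> in the bound on \<open>T\<close> pays
  for rounding the length of the first phase up to an integer.
\<close>

section \<open>Descent along a segment\<close>

lemma has_real_derivative_along_line:
  fixes f :: "'a::euclidean_space \<Rightarrow> real"
  assumes "f differentiable (at (x + s *\<^sub>R d))"
  shows "((\<lambda>s. f (x + s *\<^sub>R d)) has_real_derivative gradient f (x + s *\<^sub>R d) \<bullet> d) (at s)"
proof -
  have "(f has_derivative (\<lambda>h. h \<bullet> gradient f (x + s *\<^sub>R d))) (at (x + s *\<^sub>R d))"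
    using GDERIV_gradient[OF assms] by (simp add: gderiv_def)
  moreover have "((\<lambda>s. x + s *\<^sub>R d) has_derivative (\<lambda>h. h *\<^sub>R d)) (at s)"
    by (auto intro!: derivative_eq_intros)
  ultimately have "((\<lambda>s. f (x + s *\<^sub>R d)) has_derivative
      (\<lambda>h. (h *\<^sub>R d) \<bullet> gradient f (x + s *\<^sub>R d))) (at s)"
    using has_derivative_compose by blast
  then show ?thesis
    by (simp add: has_field_derivative_def inner_commute mult_commute_abs)
qed

text \<open>
  The quadratic upper bound, with the Lipschitz condition required only between \<open>x\<close> and the points
  of the segment: the difference of the two sides along the segment has a derivative of constant
  sign.
\<close>

lemma descent_along_segment:
  fixes f :: "'a::euclidean_space \<Rightarrow> real"
  assumes diff: "\<And>y. f differentiable (at y)"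
    and lip: "\<And>s. 0 \<le> s \<Longrightarrow> s \<le> 1 \<Longrightarrow>
      norm (gradient f (x + s *\<^sub>R d) - gradient f x) \<le> K * norm (s *\<^sub>R d)"
  shows "f (x + d) \<le> f x + gradient f x \<bullet> d + K / 2 * (norm d)\<^sup>2"
proof -
  define h where
    "h s = f (x + s *\<^sub>R d) - s * (gradient f x \<bullet> d) - K / 2 * s\<^sup>2 * (norm d)\<^sup>2" for s
  have "h 1 \<le> h 0"
  proof (rule DERIV_nonpos_imp_nonincreasing[of 0 1 h])
    fix s :: real
    assume s: "0 \<le> s" "s \<le> 1"
    let ?D = "gradient f (x + s *\<^sub>R d) \<bullet> d - gradient f x \<bullet> d - K * s * (norm d)\<^sup>2"
    have "(h has_real_derivative ?D) (at s)"
      unfolding h_def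
      by (auto intro!: derivative_eq_intros has_real_derivative_along_line diff)
    moreover have "?D \<le> 0"
    proof -
      have "(gradient f (x + s *\<^sub>R d) - gradient f x) \<bullet> d
          \<le> norm (gradient f (x + s *\<^sub>R d) - gradient f x) * norm d"
        by (rule norm_cauchy_schwarz)
      also have "\<dots> \<le> (K * norm (s *\<^sub>R d)) * norm d"
        using lip[OF s] by (rule mult_right_mono) simp
      also have "\<dots> = K * s * (norm d)\<^sup>2"
        using s by (simp add: power2_eq_square)
      finally show ?thesis
        by (simp add: inner_diff_left)
    qed
    ultimately show "\<exists>D. (h has_real_derivative D) (at s) \<and> D \<le> 0"
      by blast
  qed simp
  then show ?thesis
    by (simp add: h_def)
qed

section \<open>Consequences of strong convexity\<close>

text \<open>
  The Polyak-Lojasiewicz inequality: the lower quadratic model at \<open>u\<close> is minimised by the step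
  \<open>- gradient f u / \<mu>\<close>, and its minimum bounds \<open>f\<close> from below everywhere.
\<close>

lemma gradient_dominates_gap:
  fixes f :: "'a::real_inner \<Rightarrow> real"
  assumes "strongly_convex \<mu> f" and "\<mu> > 0"
  shows "2 * \<mu> * (f u - (INF x. f x)) \<le> (norm (gradient f u))\<^sup>2"
proof -
  let ?g = "gradient f u"
  have "f u - (norm ?g)\<^sup>2 / (2 * \<mu>) \<le> f v" for v
  proof -
    let ?d = "v - u"
    have "0 \<le> (norm (?g + \<mu> *\<^sub>R ?d))\<^sup>2"
      by simp
    also have "\<dots> = (norm ?g)\<^sup>2 + 2 * \<mu> * (?g \<bullet> ?d) + \<mu>\<^sup>2 * (norm ?d)\<^sup>2"
      using dot_norm[of ?g "\<mu> *\<^sub>R ?d"] by (simp add: power_mult_distrib)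
    finally have "- ((norm ?g)\<^sup>2 / (2 * \<mu>)) \<le> ?g \<bullet> ?d + \<mu> / 2 * (norm ?d)\<^sup>2"
      using \<open>\<mu> > 0\<close> by (simp add: field_simps power2_eq_square)
    moreover have "f u + ?g \<bullet> ?d + \<mu> / 2 * (norm ?d)\<^sup>2 \<le> f v"
      using assms(1) unfolding strongly_convex_def by blast
    ultimately show ?thesis
      by linarith
  qed
  then have "f u - (norm ?g)\<^sup>2 / (2 * \<mu>) \<le> (INF x. f x)"
    by (intro cINF_greatest) auto
  then show ?thesis
    using \<open>\<mu> > 0\<close> by (simp add: field_simps)
qed

lemma strongly_convex_tangent_le:
  assumes "strongly_convex \<mu> f" and "\<mu> > 0"
  shows "f u + gradient f u \<bullet> (v - u) \<le> f v"
proof -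
  have "f u + gradient f u \<bullet> (v - u) + \<mu> / 2 * (norm (v - u))\<^sup>2 \<le> f v"
    using assms(1) unfolding strongly_convex_def by blast
  moreover have "0 \<le> \<mu> / 2 * (norm (v - u))\<^sup>2"
    using \<open>\<mu> > 0\<close> by simp
  ultimately show ?thesis
    by linarith
qed

text \<open>
  Averaging the tangent inequalities at \<open>z\<close> towards two points that have \<open>z\<close> as their convex
  combination cancels the gradient terms.
\<close>

lemma strongly_convex_imp_convex_sublevel:
  assumes "strongly_convex \<mu> f" and "\<mu> > 0"
  shows "convex {x. f x \<le> c}"
proof (rule convexI)
  fix x y and a b :: real
  assume xy: "x \<in> {x. f x \<le> c}" "y \<in> {x. f x \<le> c}" and ab: "0 \<le> a" "0 \<le> b" "a + b = 1"
  let ?z = "a *\<^sub>R x + b *\<^sub>R y"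
  let ?g = "gradient f ?z"
  have tangent: "f ?z + ?g \<bullet> (v - ?z) \<le> c" if "v \<in> {x, y}" for v
    using strongly_convex_tangent_le[OF assms, of ?z v] xy that by auto
  have "a * (f ?z + ?g \<bullet> (x - ?z)) + b * (f ?z + ?g \<bullet> (y - ?z)) \<le> a * c + b * c"
    using tangent ab by (intro add_mono mult_left_mono) auto
  also have "\<dots> = c"
    using ab by (metis distrib_right mult_1)
  also have "a * (f ?z + ?g \<bullet> (x - ?z)) + b * (f ?z + ?g \<bullet> (y - ?z))
      = (a + b) * f ?z + ?g \<bullet> (a *\<^sub>R (x - ?z) + b *\<^sub>R (y - ?z))"
    by (simp add: inner_add_right algebra_simps)
  also have "a *\<^sub>R (x - ?z) + b *\<^sub>R (y - ?z) = ?z - (a + b) *\<^sub>R ?z"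
    by (simp only: scaleR_diff_right scaleR_left_distrib) simp
  finally show "?z \<in> {x. f x \<le> c}"
    using ab by simp
qed

section \<open>Exact line search\<close>

text \<open>The first-order optimality condition of the one-dimensional problem solved by line search.\<close>

lemma line_search_gradient_orthogonal:
  fixes f :: "'a::euclidean_space \<Rightarrow> real"
  assumes "f differentiable (at (x - \<eta> *\<^sub>R g))"
    and "\<And>e. f (x - \<eta> *\<^sub>R g) \<le> f (x - e *\<^sub>R g)"
  shows "gradient f (x - \<eta> *\<^sub>R g) \<bullet> g = 0"
proof -
  have "((\<lambda>e. f (x + e *\<^sub>R (- g))) has_real_derivative
      gradient f (x + \<eta> *\<^sub>R (- g)) \<bullet> (- g)) (at \<eta>)"
    using assms(1) by (intro has_real_derivative_along_line) simp
  moreover have "\<forall>e. \<bar>\<eta> - e\<bar> < 1 \<longrightarrow> f (x + \<eta> *\<^sub>R (- g)) \<le> f (x + e *\<^sub>R (- g))"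
    using assms(2) by simp
  ultimately have "gradient f (x + \<eta> *\<^sub>R (- g)) \<bullet> (- g) = 0"
    by (rule DERIV_local_min[OF _ zero_less_one])
  then show ?thesis
    by simp
qed

text \<open>
  The minimiser has lost the whole component of the gradient along the search direction, and a
  \<open>K\<close>-Lipschitz gradient cannot lose it within a step shorter than \<open>1 / K\<close>.
\<close>

lemma line_search_step_ge:
  fixes f :: "'a::euclidean_space \<Rightarrow> real"
  assumes diff: "\<And>y. f differentiable (at y)"
    and sc: "strongly_convex \<mu> f" "\<mu> > 0"
    and "K > 0"
    and lip: "\<And>u v. f u \<le> f x \<Longrightarrow> f v \<le> f x \<Longrightarrow>
      norm (gradient f u - gradient f v) \<le> K * norm (u - v)"
    and nz: "gradient f x \<noteq> 0"
    and min: "\<And>e. f (x - \<eta> *\<^sub>R gradient f x) \<le> f (x - e *\<^sub>R gradient f x)"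
  shows "1 / K \<le> \<eta>"
proof -
  let ?g = "gradient f x"
  let ?y = "x - \<eta> *\<^sub>R ?g"
  have g: "0 < (norm ?g)\<^sup>2"
    using nz by simp
  have decrease: "f ?y \<le> f x"
    using min[of 0] by simp
  (* Backward steps leave the sublevel set, since f lies above its tangent at x. *)
  have "f x - \<eta> * (norm ?g)\<^sup>2 \<le> f ?y"
    using strongly_convex_tangent_le[OF sc, of x ?y] by (simp add: power2_norm_eq_inner)
  then have "0 \<le> \<eta> * (norm ?g)\<^sup>2"
    using decrease by linarith
  then have "0 \<le> \<eta>"
    using g by (simp add: zero_le_mult_iff)
  have "(norm ?g)\<^sup>2 = (?g - gradient f ?y) \<bullet> ?g"
    using line_search_gradient_orthogonal[OF diff min]
    by (simp add: inner_diff_left power2_norm_eq_inner)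
  also have "\<dots> \<le> norm (?g - gradient f ?y) * norm ?g"
    by (rule norm_cauchy_schwarz)
  also have "\<dots> \<le> (K * norm (x - ?y)) * norm ?g"
    using lip[of x ?y] decrease by (intro mult_right_mono) auto
  also have "\<dots> = (K * \<eta>) * (norm ?g)\<^sup>2"
    using \<open>0 \<le> \<eta>\<close> by (simp add: power2_eq_square)
  finally have "1 \<le> K * \<eta>"
    using g by simp
  then show ?thesis
    using \<open>K > 0\<close> by (simp add: field_simps)
qed

text \<open>
  The Lipschitz bound is only required on the sublevel set of the current point. This is what
  allows the same estimate to be used with the global constant far from the minimum and with the
  local one near it.
\<close>

lemma line_search_contraction:
  fixes f :: "'a::euclidean_space \<Rightarrow> real"
  assumes diff: "\<And>y. f differentiable (at y)"
    and bdd: "bdd_below (range f)"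
    and sc: "strongly_convex \<mu> f" "\<mu> > 0"
    and "K > 0"
    and lip: "\<And>u v. f u \<le> f x \<Longrightarrow> f v \<le> f x \<Longrightarrow>
      norm (gradient f u - gradient f v) \<le> K * norm (u - v)"
    and min: "\<And>e. f (x - \<eta> *\<^sub>R gradient f x) \<le> f (x - e *\<^sub>R gradient f x)"
  shows "f (x - \<eta> *\<^sub>R gradient f x) - (INF y. f y) \<le> exp (- (\<mu> / K)) * (f x - (INF y. f y))"
proof -
  let ?g = "gradient f x"
  let ?y = "x - \<eta> *\<^sub>R ?g"
  let ?gap = "f x - (INF y. f y)"
  have gap_nonneg: "0 \<le> ?gap"
    using cINF_lower[OF bdd, of x] by simp
  have decrease: "f ?y \<le> f x"
    using min[of 0] by simp
  have "f ?y \<le> f x - (norm ?g)\<^sup>2 / (2 * K)"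
  proof (cases "?g = 0")
    case True
    then show ?thesis
      by simp
  next
    case False
    have step: "1 / K \<le> \<eta>"
      using line_search_step_ge[OF diff sc \<open>K > 0\<close> lip False min] .
    then have "0 < \<eta>"
      using \<open>K > 0\<close> by (meson divide_pos_pos less_le_trans zero_less_one)
    let ?d = "- (1 / K) *\<^sub>R ?g"
    have "f (x + ?d) \<le> f x + ?g \<bullet> ?d + K / 2 * (norm ?d)\<^sup>2"
    proof (rule descent_along_segment[OF diff])
      fix s :: real
      assume s: "0 \<le> s" "s \<le> 1"
      (* The weight of the line search point in the convex combination with x. *)
      define r where "r = (s / K) / \<eta>"
      have "s / K \<le> \<eta>"
        using divide_right_mono[of s 1 K] s step \<open>K > 0\<close> by linarith
      then have r: "0 \<le> r" "r \<le> 1"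
        using s \<open>0 < \<eta>\<close> \<open>K > 0\<close> unfolding r_def by (simp, simp only: divide_le_eq_1_pos)
      have "r * \<eta> = s / K"
        using \<open>0 < \<eta>\<close> by (simp add: r_def)
      then have "x + s *\<^sub>R ?d = (1 - r) *\<^sub>R x + r *\<^sub>R ?y"
        by (simp add: scaleR_diff_right scaleR_diff_left)
      also have "\<dots> \<in> {z. f z \<le> f x}"
        using r decrease
        by (intro convexD[OF strongly_convex_imp_convex_sublevel[OF sc]]) auto
      finally have "f (x + s *\<^sub>R ?d) \<le> f x"
        by simp
      then show "norm (gradient f (x + s *\<^sub>R ?d) - gradient f x) \<le> K * norm (s *\<^sub>R ?d)"
        using lip[of "x + s *\<^sub>R ?d" x] by simp
    qed
    also have "\<dots> = f x - (norm ?g)\<^sup>2 / (2 * K)"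
      using \<open>K > 0\<close> by (simp add: power_mult_distrib power2_norm_eq_inner[symmetric]
          field_simps power2_eq_square)
    finally show ?thesis
      using min[of "1 / K"] by simp
  qed
  also have "\<dots> \<le> f x - 2 * \<mu> * ?gap / (2 * K)"
    using gradient_dominates_gap[OF sc, of x] \<open>K > 0\<close>
    by (intro diff_left_mono divide_right_mono) auto
  finally have "f ?y - (INF y. f y) \<le> (1 + - (\<mu> / K)) * ?gap"
    using \<open>K > 0\<close> by (simp add: field_simps)
  (* An exponential factor is positive, so estimates can be iterated without comparing \<mu> with K. *)
  also have "\<dots> \<le> exp (- (\<mu> / K)) * ?gap"
    using gap_nonneg by (intro mult_right_mono exp_ge_add_one_self)
  finally show ?thesis .
qed

section \<open>Geometric decay and the two phases\<close>

lemma exp_contraction_iterate: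
  fixes a :: "nat \<Rightarrow> real"
  assumes "\<And>t. t \<ge> m \<Longrightarrow> a (Suc t) \<le> exp (- r) * a t"
  shows "a (m + n) \<le> exp (- (r * real n)) * a m"
proof (induction n)
  case 0
  show ?case
    by simp
next
  case (Suc n)
  have "a (m + Suc n) \<le> exp (- r) * a (m + n)"
    using assms[of "m + n"] by simp
  also have "\<dots> \<le> exp (- r) * (exp (- (r * real n)) * a m)"
    using Suc.IH by (rule mult_left_mono) simp
  also have "\<dots> = exp (- (r * real (Suc n))) * a m"
    by (simp add: mult.assoc[symmetric] exp_add[symmetric] algebra_simps)
  finally show ?case .
qed

lemma exp_contraction_reaches:
  fixes a :: "nat \<Rightarrow> real"
  assumes contr: "\<And>t. t \<ge> m \<Longrightarrow> a (Suc t) \<le> exp (- (\<mu> / K)) * a t"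
    and "K > 0" "\<mu> > 0" and "A > 0" "B > 0" and start: "a m \<le> A"
    and n: "K / \<mu> * ln (A / B) \<le> real n"
  shows "a (m + n) \<le> B"
proof -
  have "ln (A / B) \<le> \<mu> / K * real n"
    using n \<open>K > 0\<close> \<open>\<mu> > 0\<close> by (simp add: field_simps)
  then have "exp (- (\<mu> / K * real n)) \<le> exp (- ln (A / B))"
    by simp
  also have "\<dots> = B / A"
    using \<open>A > 0\<close> \<open>B > 0\<close> by (simp add: exp_minus)
  finally have rate: "exp (- (\<mu> / K * real n)) \<le> B / A" .
  have "a (m + n) \<le> exp (- (\<mu> / K * real n)) * a m"
    using contr by (rule exp_contraction_iterate)
  also have "\<dots> \<le> exp (- (\<mu> / K * real n)) * A"
    using start by (rule mult_left_mono) simp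
  also have "\<dots> \<le> B / A * A"
    using rate \<open>A > 0\<close> by (intro mult_right_mono) auto
  finally show ?thesis
    using \<open>A > 0\<close> by simp
qed

theorem theorem1:
  fixes f :: "real ^ 'd \<Rightarrow> real"
    and L Ls \<delta> \<mu> fs \<Delta>0 \<epsilon> :: real
    and w0 :: "real ^ 'd"
    and w :: "nat \<Rightarrow> real ^ 'd"
    and \<eta> :: "nat \<Rightarrow> real"
    and T :: nat
  assumes "\<And>x. f differentiable (at x)"
    and "L > 0" and "Ls > 0" and "\<delta> > 0" and "\<mu> > 0"
    and "glocally_smooth f L Ls \<delta>"
    and "strongly_convex \<mu> f"
    and "fs = (INF x. f x)"
    and "\<Delta>0 = f w0 - fs"
    and "\<Delta>0 > \<delta>" and "\<delta> > \<epsilon>" and "\<epsilon> > 0"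
    and "w 0 = w0"
    and "\<And>t. w (Suc t) = w t - \<eta> t *\<^sub>R gradient f (w t)"
    and "\<And>t. is_arg_min (\<lambda>e. f (w t - e *\<^sub>R gradient f (w t))) (\<lambda>_. True) (\<eta> t)"
    and "real T \<ge> L / \<mu> * ln (\<Delta>0 / \<delta>) + Ls / \<mu> * ln (\<delta> / \<epsilon>) + 1"
  shows "f (w T) - fs \<le> \<epsilon>"
proof -
  note diff = assms(1) and sc = assms(7) and fs = assms(8)
  note glocal = assms(6)[unfolded glocally_smooth_def, folded fs]
  have bdd: "bdd_below (range f)"
    using glocal by (rule conjunct1)
  define a where "a t = f (w t) - fs" for t
  have step: "a (Suc t) \<le> exp (- (\<mu> / K)) * a t"
    if "K > 0" and lip: "\<And>u v. f u \<le> f (w t) \<Longrightarrow> f v \<le> f (w t) \<Longrightarrow>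
      norm (gradient f u - gradient f v) \<le> K * norm (u - v)" for K t
  proof -
    have "f (w t - \<eta> t *\<^sub>R gradient f (w t)) \<le> f (w t - e *\<^sub>R gradient f (w t))" for e
      using assms(15)[of t] by (auto simp: is_arg_min_def not_less)
    from line_search_contraction[OF diff bdd sc \<open>\<mu> > 0\<close> \<open>K > 0\<close> lip this]
    show ?thesis
      by (simp add: a_def fs assms(14))
  qed
  have far: "a (Suc t) \<le> exp (- (\<mu> / L)) * a t" for t
    using glocal \<open>L > 0\<close> by (intro step) auto
  have near: "a (Suc t) \<le> exp (- (\<mu> / Ls)) * a t" if "a t \<le> \<delta>" for t
  proof (intro step)
    fix u v
    assume "f u \<le> f (w t)" "f v \<le> f (w t)"
    then have "f u - fs \<le> \<delta>" "f v - fs \<le> \<delta>"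
      using that by (auto simp: a_def)
    then show "norm (gradient f u - gradient f v) \<le> Ls * norm (u - v)"
      using glocal by blast
  qed (rule \<open>Ls > 0\<close>)
  let ?x = "L / \<mu> * ln (\<Delta>0 / \<delta>)" and ?y = "Ls / \<mu> * ln (\<delta> / \<epsilon>)"
  define m where "m = nat \<lceil>?x\<rceil>"
  have "0 < ln (\<Delta>0 / \<delta>)" "0 < ln (\<delta> / \<epsilon>)"
    using assms(4,10,11,12) by (auto intro!: ln_gt_zero)
  then have "0 \<le> ?x" "0 \<le> ?y"
    using assms(2,3,5) by simp_all
  have m: "?x \<le> real m" "real m \<le> ?x + 1"
    using \<open>0 \<le> ?x\<close> unfolding m_def by linarith+
  have entered: "a m \<le> \<delta>"
    using exp_contraction_reaches[of 0 a \<mu> L \<Delta>0 \<delta> m] far m(1) assms(2,4,5,9,10,13)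
    by (simp add: a_def)
  have stays: "a t \<le> \<delta>" if "t \<ge> m" for t
    using that
  proof (induction t rule: dec_induct)
    case base
    show ?case
      by (rule entered)
  next
    case (step t)
    have "f (w (Suc t)) \<le> f (w t - 0 *\<^sub>R gradient f (w t))"
      using assms(15)[of t] by (auto simp: is_arg_min_def not_less assms(14) simp del: scale_zero_left)
    then show ?case
      using step.IH by (simp add: a_def)
  qed
  have "real m \<le> real T" "?y \<le> real T - real m"
    using m(2) assms(16) \<open>0 \<le> ?y\<close> by linarith+
  then have "m \<le> T" and n: "?y \<le> real (T - m)"
    by auto
  have "a (m + (T - m)) \<le> \<epsilon>"
    using near[OF stays] assms(3,5,4,12) entered n by (rule exp_contraction_reaches)
  then show ?thesis
    using \<open>m \<le> T\<close> by (simp add: a_def)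
qed

end
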